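(* Let $0<\beta<1$ and $r<0$. Let $u$ be the solution of the Caputo fractional initial value problem $$D^\beta_t u-ru=0,\quad t>0,\qquad u(0)=1,$$ namely $u(t)=E_\beta(rt^\beta)$. Then $$\beta=-\lim_{t\to\infty}\frac{t\,u'(t)}{u(t)}.$$
   Context: For $0<\beta<1$, the Caputo fractional derivative (lower terminal $0$) is $(D^\beta_t f)(t)=\frac{1}{\Gamma(1-\beta)}\int_0^t (t-\tau)^{-\beta}f'(\tau)\,d\tau$, $t>0$. The Mittag-Leffler function is $E_\alpha(z)=\sum_{k\ge0}\frac{z^k}{\Gamma(k\alpha+1)}$. *)

theory Defs
  imports "HOL-Analysis.Analysis"
begin

definition mittag_leffler :: "real \<Rightarrow> real \<Rightarrow> real" where
  "mittag_leffler \<alpha> z = (\<Sum>k. z ^ k / Gamma (real k * \<alpha> + 1))"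

definition caputo :: "real \<Rightarrow> (real \<Rightarrow> real) \<Rightarrow> real \<Rightarrow> real" where
  "caputo \<beta> f t = (1 / Gamma (1 - \<beta>)) * integral {0..t} (\<lambda>\<tau>. (t - \<tau>) powr (-\<beta>) * deriv f \<tau>)"

end

theory Submission
  imports Defs "HOL-Complex_Analysis.Complex_Analysis" "HOL-Real_Asymp.Real_Asymp"
begin

text \<open>
  With \<open>x = - r t\<^sup>\<beta>\<close> the quotient \<open>t u'(t) / u(t)\<close> equals \<open>\<beta> Q(x) / P(x)\<close>, where
  \<open>P(x) = \<Sum>k. (-x)^k / \<Gamma>(\<beta>k + 1)\<close> and \<open>Q(x) = \<Sum>k. k (-x)^k / \<Gamma>(\<beta>k + 1)\<close>. Inserting Hankel's
  integral for \<open>1 / \<Gamma>\<close> and summing under the integral turns both series into Hankel integrals of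
  \<open>\<phi>(x z^{-\<beta>}) e^z / z\<close>, with \<open>\<phi>(\<zeta>) = 1 / (1 + \<zeta>)\<close> and \<open>\<phi>(\<zeta>) = - \<zeta> / (1 + \<zeta>)\<^sup>2\<close> respectively.
  As \<open>\<beta> < 1\<close>, these integrands are holomorphic off the negative real axis, so the contour collapses
  onto the cut, and dominated convergence gives \<open>x P(x) \<rightarrow> 1 / \<Gamma>(1 - \<beta>)\<close> and
  \<open>x Q(x) \<rightarrow> - 1 / \<Gamma>(1 - \<beta>)\<close>.

  In the coordinate \<open>w = ln z\<close> the slit plane is the strip \<open>\<bar>Im w\<bar> < \<pi>\<close> and no branch cuts remain.
  There the integral \<open>vint h L\<close> over the vertical segment at abscissa \<open>L\<close> has derivative \<open>jump h L\<close>,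
  the difference of \<open>h\<close> across the strip; the Hankel integral is the limit of \<open>vint h L\<close> as
  \<open>L \<rightarrow> \<infinity>\<close>, and collapsing the contour means letting \<open>L \<rightarrow> -\<infinity>\<close>.
\<close>

section \<open>Contour integrals over vertical segments in the logarithmic coordinate\<close>

definition vint :: "(complex \<Rightarrow> complex) \<Rightarrow> real \<Rightarrow> complex" where
  "vint h L = \<i> * integral {-pi..pi} (\<lambda>\<theta>. h (Complex L \<theta>))"

definition jump :: "(complex \<Rightarrow> complex) \<Rightarrow> real \<Rightarrow> complex" where
  "jump h v = h (Complex v pi) - h (Complex v (- pi))"

text \<open>Substituting t = exp v in Euler's integral. The integrand
  \<open>exp (a * v - exp v)\<close> is the modulus profile of every jump across the cut below, so
  this lemma supplies both the value of the Hankel jump integral and the dominating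
  functions.\<close>

lemma exp_substitution_Gamma_integral:
  fixes a :: real
  assumes "a > 0"
  shows "integrable lborel (\<lambda>v. exp (a * v - exp v))"
    and "(LINT v|lborel. exp (a * v - exp v)) = Gamma a"
proof -
  define f where "f = (\<lambda>t::real. t powr (a - 1) / exp t)"
  \<comment> \<open>The range of \<open>exp\<close> omits 0, so the endpoint is removed as a null
    set before changing variables.\<close>
  have f_int: "(f has_integral Gamma a) {0<..}"
  proof -
    have "(f has_integral Gamma a) {0..}"
      unfolding f_def using Gamma_integral_real[OF assms] .
    moreover have "negligible {x \<in> {0..} - {0<..}. f x \<noteq> 0}" "negligible {x \<in> {0<..} - {0..}. f x \<noteq> 0}"
      by (auto intro: negligible_subset[of "{0}"])
    ultimately show ?thesis
      using has_integral_spike_set_eq by blast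
  qed
  have range: "range exp = {0::real<..}"
    by (auto simp: image_def) (metis exp_ln)
  have "f absolutely_integrable_on {0<..}"
    using f_int by (intro nonnegative_absolutely_integrable_1) (auto simp: f_def integrable_on_def)
  then have "(\<lambda>x. \<bar>exp x\<bar> * f (exp x)) absolutely_integrable_on UNIV \<and>
      integral UNIV (\<lambda>x. \<bar>exp x\<bar> * f (exp x)) = Gamma a"
    using has_absolute_integral_change_of_variables_1'
      [of UNIV exp exp f "Gamma a"] f_int
    by (auto simp: range integral_unique inj_def intro: DERIV_exp)
  moreover have "\<bar>exp x\<bar> * f (exp x) = exp (a * x - exp x)" for x
  proof -
    have "f (exp x) = exp ((a - 1) * x - exp x)"
      unfolding f_def by (simp add: powr_def exp_diff)
    then show ?thesis
      by (simp flip: exp_add add: algebra_simps)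
  qed
  ultimately have *: "(\<lambda>x. exp (a * x - exp x)) absolutely_integrable_on UNIV"
      "integral UNIV (\<lambda>x. exp (a * x - exp x)) = Gamma a"
    by simp_all
  have m: "(\<lambda>x. exp (a * x - exp x)) \<in> borel_measurable lborel"
    by simp
  from * show i: "integrable lborel (\<lambda>v. exp (a * v - exp v))"
    using m by (simp add: set_integrable_def integrable_completion)
  show "(LINT v|lborel. exp (a * v - exp v)) = Gamma a"
    using integral_lborel[OF i] * by simp
qed

lemma vint_eq_jump_primitive:
  assumes "\<And>\<theta>. \<bar>\<theta>\<bar> \<le> pi \<Longrightarrow> (g has_field_derivative h (Complex L \<theta>)) (at (Complex L \<theta>))"
  shows "vint h L = jump g L"
proof -
  have "((\<lambda>\<theta>. g (Complex L \<theta>)) has_vector_derivative \<i> * h (Complex L \<theta>)) (at \<theta> within {-pi..pi})"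
    if "\<theta> \<in> {-pi..pi}" for \<theta>
  proof -
    have "((\<lambda>\<theta>. Complex L \<theta>) has_vector_derivative \<i>) (at \<theta> within {-pi..pi})"
      unfolding Complex_eq by (auto intro!: derivative_eq_intros)
    moreover have "(g has_field_derivative h (Complex L \<theta>)) (at (Complex L \<theta>) within (Complex L ` {-pi..pi}))"
      using assms[of \<theta>] that by (auto intro: has_field_derivative_at_within)
    ultimately have "((g \<circ> Complex L) has_vector_derivative \<i> * h (Complex L \<theta>)) (at \<theta> within {-pi..pi})"
      by (rule field_vector_diff_chain_within)
    then show ?thesis by (simp add: o_def)
  qed
  then have "((\<lambda>\<theta>. \<i> * h (Complex L \<theta>)) has_integral g (Complex L pi) - g (Complex L (- pi))) {-pi..pi}"
    by (intro fundamental_theorem_of_calculus) auto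
  then show ?thesis
    unfolding vint_def jump_def by (metis integral_mult_right integral_unique)
qed

text \<open>The half-width stays a parameter, assumed larger than pi below, so that the lines Im w =
  pi and Im w = -pi lie inside an open convex domain of holomorphy. Entire integrands use 2 pi, the
  series kernels use pi / \<beta>.\<close>

definition strip :: "real \<Rightarrow> complex set" where
  "strip b = {w. \<bar>Im w\<bar> < b}"

lemma open_strip: "open (strip b)"
  unfolding strip_def by (intro open_Collect_less continuous_intros)

lemma convex_strip: "convex (strip b)"
proof -
  have "strip b = {w. Im w < b} \<inter> {w. Im w > - b}"
    by (auto simp: strip_def)
  then show ?thesis
    by (auto intro: convex_Int convex_halfspace_Im_lt convex_halfspace_Im_gt)
qed

lemma Complex_in_strip [simp]: "\<bar>\<theta>\<bar> \<le> pi \<Longrightarrow> pi < b \<Longrightarrow> Complex v \<theta> \<in> strip b"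
  by (simp add: strip_def)

text \<open>A primitive \<open>g\<close> exists because the strip is convex. Then
  \<open>vint h\<close> is \<open>jump g\<close>, and differentiating the two boundary values of
  \<open>g\<close> replaces any differentiation under the integral sign.\<close>

lemma vint_has_vector_derivative:
  assumes h: "h holomorphic_on strip b" and b: "pi < b"
  shows "(vint h has_vector_derivative jump h v) (at v)"
proof -
  have "\<exists>g. \<forall>x\<in>strip b. (g has_field_derivative h x) (at x within strip b)"
    by (rule holomorphic_convex_primitive'[OF convex_strip open_strip h]) (rule exI, rule ballI)
  then obtain g where g: "\<And>x. x \<in> strip b \<Longrightarrow> (g has_field_derivative h x) (at x within strip b)"
    by auto
  have g': "(g has_field_derivative h x) (at x)" if "x \<in> strip b" for x
    using g[OF that] unfolding at_within_open[OF that open_strip] .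
  have "vint h = jump g"
    by (rule ext, rule vint_eq_jump_primitive) (use b in \<open>auto intro!: g'\<close>)
  moreover have "((\<lambda>v. g (Complex v \<theta>)) has_vector_derivative h (Complex v \<theta>)) (at v)"
    if "\<bar>\<theta>\<bar> \<le> pi" for \<theta>
  proof -
    have "((\<lambda>v. Complex v \<theta>) has_vector_derivative 1) (at v)"
      unfolding Complex_eq by (auto intro!: derivative_eq_intros)
    from field_vector_diff_chain_at[OF this g'] that b show ?thesis
      by (simp add: o_def)
  qed
  ultimately show ?thesis
    by (auto simp: jump_def[abs_def] intro!: derivative_intros)
qed

lemma continuous_on_Complex_strip:
  assumes "h holomorphic_on strip b" "pi < b"
  shows "continuous_on {-pi..pi} (\<lambda>\<theta>. h (Complex L \<theta>))"
proof -
  have "continuous_on (strip b) h"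
    by (rule holomorphic_on_imp_continuous_on) fact
  moreover have "continuous_on {-pi..pi} (Complex L)"
    unfolding Complex_eq[abs_def] by (intro continuous_intros)
  ultimately show ?thesis
    using assms(2) by (elim continuous_on_compose2) auto
qed

lemma continuous_on_jump:
  assumes "h holomorphic_on strip b" "pi < b"
  shows "continuous_on UNIV (jump h)"
proof -
  have "continuous_on (strip b) h"
    by (rule holomorphic_on_imp_continuous_on) fact
  moreover have "continuous_on UNIV (\<lambda>v. Complex v \<theta>)" for \<theta>
    unfolding Complex_eq by (intro continuous_intros)
  ultimately have "continuous_on UNIV (\<lambda>v. h (Complex v \<theta>))" if "\<bar>\<theta>\<bar> \<le> pi" for \<theta>
    using assms(2) that by (elim continuous_on_compose2) auto
  then show ?thesis
    unfolding jump_def by (intro continuous_intros) auto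
qed

lemma norm_vint_diff_le:
  assumes h: "h holomorphic_on strip b" and b: "pi < b"
    and bound: "\<And>\<theta>. \<bar>\<theta>\<bar> \<le> pi \<Longrightarrow> norm (h (Complex L \<theta>) - c) \<le> B"
  shows "norm (vint h L - 2 * pi * \<i> * c) \<le> 2 * pi * B"
proof -
  have int: "(\<lambda>\<theta>. h (Complex L \<theta>)) integrable_on {-pi..pi}"
    by (intro integrable_continuous_real continuous_on_Complex_strip[OF h b])
  have "((\<lambda>\<theta>. h (Complex L \<theta>) - c) has_integral
      (integral {-pi..pi} (\<lambda>\<theta>. h (Complex L \<theta>)) - (pi - (- pi)) *\<^sub>R c)) {-pi..pi}"
    using has_integral_const_real[of c "-pi" pi] int
    by (intro has_integral_diff) (auto simp: integrable_integral)
  moreover have "0 \<le> B"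
    using bound[of 0] norm_ge_zero by (metis abs_zero order_trans pi_ge_zero)
  ultimately have "norm (integral {-pi..pi} (\<lambda>\<theta>. h (Complex L \<theta>)) - (pi - (- pi)) *\<^sub>R c)
      \<le> B * measure lborel {-pi..pi}"
    using bound by (intro has_integral_bound_real[where S = "{}"]) auto
  moreover have "vint h L - 2 * pi * \<i> * c
      = \<i> * (integral {-pi..pi} (\<lambda>\<theta>. h (Complex L \<theta>)) - (pi - (- pi)) *\<^sub>R c)"
    by (simp add: vint_def algebra_simps scaleR_conv_of_real)
  ultimately show ?thesis
    by (simp add: norm_mult mult.commute)
qed

text \<open>If \<open>h\<close> tends to \<open>c\<close> uniformly on the segments far to the left,
  their integrals tend to 2 pi i c. In the variable z = exp w this is the residue of c / z at the
  origin, since dw = dz / z.\<close>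

lemma vint_tendsto_at_bot:
  assumes h: "h holomorphic_on strip b" and b: "pi < b"
    and bound: "\<And>L \<theta>. \<bar>\<theta>\<bar> \<le> pi \<Longrightarrow> norm (h (Complex L \<theta>) - c) \<le> B L"
    and B: "(B \<longlongrightarrow> 0) at_bot"
  shows "(vint h \<longlongrightarrow> 2 * pi * \<i> * c) at_bot"
proof -
  have "((\<lambda>L. vint h L - 2 * pi * \<i> * c) \<longlongrightarrow> 0) at_bot"
  proof (rule tendsto_0_le)
    show "\<forall>\<^sub>F L in at_bot. norm (vint h L - 2 * pi * \<i> * c) \<le> norm (B L) * (2 * pi)"
    proof (rule always_eventually, rule allI)
      fix L
      have "norm (vint h L - 2 * pi * \<i> * c) \<le> 2 * pi * B L"
        by (rule norm_vint_diff_le[OF h b bound])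
      also have "\<dots> \<le> norm (B L) * (2 * pi)"
        by (simp add: mult.commute)
      finally show "norm (vint h L - 2 * pi * \<i> * c) \<le> norm (B L) * (2 * pi)" .
    qed
  qed fact
  then show ?thesis
    using LIM_zero_iff by blast
qed

text \<open>This is the collapse of the contour: by the fundamental theorem of calculus
  \<open>vint h M - vint h (- M)\<close> is the integral of \<open>jump h\<close> over [-M, M], and
  integrability of the jump lets M tend to infinity.\<close>

lemma vint_tendsto_at_top:
  assumes h: "h holomorphic_on strip b" and b: "pi < b"
    and int: "integrable lborel (jump h)"
    and bot: "(vint h \<longlongrightarrow> A) at_bot"
  shows "(vint h \<longlongrightarrow> A + (LINT v|lborel. jump h v)) at_top"
proof -
  have "((\<lambda>M. LINT v|lborel. indicator {-M..M} v *\<^sub>R jump h v) \<longlongrightarrow> (LINT v|lborel. jump h v)) at_top"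
  proof (rule integral_dominated_convergence_at_top[where w = "\<lambda>v. norm (jump h v)"])
    show "AE v in lborel. ((\<lambda>M. indicator {-M..M} v *\<^sub>R jump h v) \<longlongrightarrow> jump h v) at_top"
    proof (rule AE_I2, rule tendsto_eventually)
      fix v :: real
      show "\<forall>\<^sub>F M in at_top. indicator {-M..M} v *\<^sub>R jump h v = jump h v"
        using eventually_ge_at_top[of "\<bar>v\<bar>"] by eventually_elim (auto simp: indicator_def)
    qed
  qed (use int in \<open>auto intro!: always_eventually simp: indicator_def\<close>)
  moreover have "\<forall>\<^sub>F M in at_top. (LINT v|lborel. indicator {-M..M} v *\<^sub>R jump h v) = vint h M - vint h (- M)"
    using eventually_ge_at_top[of 0]
  proof eventually_elim
    case (elim M)
    then show ?case
      by (intro integral_FTC_Icc) 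
        (auto intro!: continuous_on_subset[OF continuous_on_jump[OF h b]]
           has_vector_derivative_at_within[OF vint_has_vector_derivative[OF h b]])
  qed
  ultimately have "((\<lambda>M. vint h M - vint h (- M)) \<longlongrightarrow> (LINT v|lborel. jump h v)) at_top"
    using tendsto_cong by fast
  moreover have "((\<lambda>M. vint h (- M)) \<longlongrightarrow> A) at_top"
    using bot by (simp add: filterlim_at_bot_mirror)
  ultimately show ?thesis
    using tendsto_add[of "\<lambda>M. vint h (- M)" A at_top "\<lambda>M. vint h M - vint h (- M)"]
    by simp
qed

section \<open>Hankel's integral for the reciprocal Gamma function\<close>

text \<open>Hankel's integrand exp(z) z^(-s) dz under z = exp w; the 1 in \<open>1 - s\<close> comes
  from dz = exp w dw.\<close>

definition hankel :: "real \<Rightarrow> complex \<Rightarrow> complex" where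
  "hankel s w = exp (exp w + of_real (1 - s) * w)"

lemma holomorphic_hankel: "hankel s holomorphic_on A"
  unfolding hankel_def[abs_def] by (intro holomorphic_intros)

lemma norm_exp_exp_le: "norm (exp (exp (Complex L \<theta>))) \<le> exp (exp L)"
  using norm_exp[of "exp (Complex L \<theta>)"] by simp

lemma norm_hankel_le: "norm (hankel s (Complex L \<theta>)) \<le> exp (exp L) * exp ((1 - s) * L)"
proof -
  have "norm (hankel s (Complex L \<theta>)) = norm (exp (exp (Complex L \<theta>))) * exp ((1 - s) * L)"
    unfolding hankel_def by (simp add: exp_add norm_mult)
  then show ?thesis
    using norm_exp_exp_le by (simp add: mult_right_mono)
qed

lemma exp_Complex_pi: "exp (Complex v pi) = - of_real (exp v)" "exp (Complex v (- pi)) = - of_real (exp v)"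
  by (simp_all add: complex_eq_iff Re_exp Im_exp)

text \<open>On both boundary lines exp w equals -exp v, so the two values differ only in the phases
  exp(i pi (1 - s)) and exp(-i pi (1 - s)), whose difference is 2 i sin(pi (1 - s)).\<close>

lemma jump_hankel:
  "jump (hankel s) v = of_real (exp ((1 - s) * v - exp v)) * (2 * \<i> * of_real (sin (pi * (1 - s))))"
proof -
  have "hankel s (Complex v \<theta>) = of_real (exp ((1 - s) * v - exp v)) * cis (\<theta> * (1 - s))"
    if "exp (Complex v \<theta>) = - of_real (exp v)" for \<theta>
  proof -
    have "exp (Complex v \<theta>) + of_real (1 - s) * Complex v \<theta>
        = of_real ((1 - s) * v - exp v) + \<i> * of_real (\<theta> * (1 - s))"
      using that by (simp add: Complex_eq algebra_simps)
    then show ?thesis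
      unfolding hankel_def exp_of_real cis_conv_exp by (simp only: exp_add exp_of_real)
  qed
  from this[OF exp_Complex_pi(1)] this[OF exp_Complex_pi(2)] show ?thesis
    by (simp add: jump_def complex_eq_iff algebra_simps)
qed

lemma norm_jump_hankel_le: "norm (jump (hankel s) v) \<le> 2 * exp ((1 - s) * v - exp v)"
proof -
  have "norm (jump (hankel s) v) = exp ((1 - s) * v - exp v) * (2 * \<bar>sin (pi * (1 - s))\<bar>)"
    unfolding jump_hankel norm_mult norm_of_real by simp
  also have "\<dots> \<le> exp ((1 - s) * v - exp v) * (2 * 1)"
    by (intro mult_left_mono) auto
  finally show ?thesis
    by simp
qed

text \<open>Euler's reflection formula. Writing it with \<open>rGamma s\<close> covers the
  nonpositive integers, where both sides vanish.\<close>

lemma Gamma_sin_eq_rGamma: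
  fixes s :: real
  assumes "s < 1"
  shows "Gamma (1 - s) * sin (pi * (1 - s)) = pi * rGamma s"
proof -
  have "complex_of_real (rGamma s * rGamma (1 - s)) = of_real (sin (pi * s) / pi)"
    using rGamma_reflection_complex[of "of_real s"]
    by (simp flip: rGamma_complex_of_real sin_of_real)
  then have "rGamma s * rGamma (1 - s) = sin (pi * s) / pi"
    unfolding of_real_eq_iff .
  then have "pi * rGamma s = Gamma (1 - s) * sin (pi * s)"
    using rGamma_eq_zero_iff[of "1 - s"] assms nonpos_Ints_nonpos[of "1 - s"]
    by (auto simp add: Gamma_def field_simps)
  moreover have "sin (pi * (1 - s)) = sin (pi * s)"
    using sin_pi_minus[of "pi * s"] by (simp add: algebra_simps)
  ultimately show ?thesis
    by simp
qed

lemma LINT_jump_hankel: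
  assumes "s < 1"
  shows "integrable lborel (jump (hankel s))"
    and "(LINT v|lborel. jump (hankel s) v) = 2 * pi * \<i> * of_real (rGamma s)"
proof -
  have "0 < 1 - s"
    using assms by simp
  note G = exp_substitution_Gamma_integral[OF this]
  show "integrable lborel (jump (hankel s))"
    unfolding jump_hankel[abs_def] using G(1) by (intro integrable_mult_left integrable_of_real)
  have "(LINT v|lborel. jump (hankel s) v) = of_real (Gamma (1 - s)) * (2 * \<i> * of_real (sin (pi * (1 - s))))"
    unfolding jump_hankel integral_mult_left_zero integral_complex_of_real G(2) ..
  also have "\<dots> = 2 * \<i> * of_real (Gamma (1 - s) * sin (pi * (1 - s)))"
    by simp
  finally show "(LINT v|lborel. jump (hankel s) v) = 2 * pi * \<i> * of_real (rGamma s)"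
    unfolding Gamma_sin_eq_rGamma[OF assms] by simp
qed

lemma exp_exp_mult_tendsto_at_bot:
  fixes c :: real
  assumes "0 < c"
  shows "((\<lambda>L. exp (exp L) * exp (c * L)) \<longlongrightarrow> 0) at_bot"
  using assms by real_asymp

text \<open>For s < 1 nothing is left at minus infinity and the jump integral gives the value by
  reflection. At s = 1 the roles are exchanged: the jump vanishes and the whole value is the residue
  2 pi i at z = 0.\<close>

lemma vint_hankel_tendsto_base:
  assumes "0 < s" "s \<le> 1"
  shows "(vint (hankel s) \<longlongrightarrow> 2 * pi * \<i> * of_real (rGamma s)) at_top"
proof (cases "s = 1")
  case True
  have B: "((\<lambda>L::real. exp (exp L) * exp L) \<longlongrightarrow> 0) at_bot"
    by real_asymp
  have "norm (hankel s (Complex L \<theta>) - 1) \<le> exp (exp L) * exp L" for L \<theta>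
  proof -
    have "\<bar>Re (exp (Complex L \<theta>))\<bar> \<le> exp L"
      using abs_Re_le_cmod[of "exp (Complex L \<theta>)"] by simp
    then show ?thesis
      \<comment> \<open>The Taylor remainder of order 0 bounds |exp z - 1| by exp |Re z| times |z|,
        here with |z| = exp L.\<close>
      using Taylor_exp[of "exp (Complex L \<theta>)" 0] True
      by (simp add: hankel_def) (smt (verit) exp_le_cancel_iff mult_right_mono exp_ge_zero)
  qed
  then have "(vint (hankel s) \<longlongrightarrow> 2 * pi * \<i> * 1) at_bot"
    using B by (intro vint_tendsto_at_bot[OF holomorphic_hankel, of "2 * pi"]) auto
  from vint_tendsto_at_top[OF holomorphic_hankel _ _ this, of "2 * pi"] show ?thesis
    using True by (simp add: jump_hankel[abs_def])
next
  case False
  with assms have s: "s < 1" by simp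
  have B: "((\<lambda>L::real. exp (exp L) * exp ((1 - s) * L)) \<longlongrightarrow> 0) at_bot"
    using exp_exp_mult_tendsto_at_bot s by simp
  have "(vint (hankel s) \<longlongrightarrow> 2 * pi * \<i> * 0) at_bot"
    using norm_hankel_le B by (intro vint_tendsto_at_bot[OF holomorphic_hankel, of "2 * pi"]) auto
  from vint_tendsto_at_top[OF holomorphic_hankel _ LINT_jump_hankel(1)[OF s] this, of "2 * pi"] show ?thesis
    by (simp add: LINT_jump_hankel(2)[OF s])
qed

text \<open>Integration by parts: the derivative of \<open>hankel s\<close> is
  \<open>hankel (s - 1)\<close> plus \<open>1 - s\<close> times \<open>hankel s\<close>. Up to the
  boundary term \<open>jump\<close> this is the recurrence 1/Gamma(s - 1) = (s -
  1)/Gamma(s).\<close>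

lemma vint_hankel_minus_1:
  "vint (hankel (s - 1)) L = of_real (s - 1) * vint (hankel s) L + jump (hankel s) L"
proof -
  have int: "(\<lambda>\<theta>. hankel s (Complex L \<theta>)) integrable_on {-pi..pi}" for s
    by (intro integrable_continuous_real continuous_on_Complex_strip[OF holomorphic_hankel, of "2 * pi"]) auto
  have "vint (\<lambda>w. hankel (s - 1) w + of_real (1 - s) * hankel s w) L = jump (hankel s) L"
  proof (rule vint_eq_jump_primitive)
    fix \<theta> :: real
    have "(hankel s has_field_derivative hankel s w * (exp w + of_real (1 - s))) (at w)" for w
      unfolding hankel_def[abs_def] by (auto intro!: derivative_eq_intros)
    moreover have "hankel s w * (exp w + of_real (1 - s)) = hankel (s - 1) w + of_real (1 - s) * hankel s w" for w
    proof -
      have "hankel (s - 1) w = hankel s w * exp w"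
        unfolding hankel_def by (simp add: algebra_simps flip: exp_add)
      then show ?thesis by (simp add: algebra_simps)
    qed
    ultimately show "(hankel s has_field_derivative hankel (s - 1) (Complex L \<theta>) +
        of_real (1 - s) * hankel s (Complex L \<theta>)) (at (Complex L \<theta>))"
      by metis
  qed
  moreover have "vint (\<lambda>w. hankel (s - 1) w + of_real (1 - s) * hankel s w) L
      = vint (hankel (s - 1)) L + of_real (1 - s) * vint (hankel s) L"
    unfolding vint_def using int
    by (subst integral_add) (auto simp: distrib_left intro: integrable_on_mult_right simp del: of_real_diff)
  ultimately show ?thesis
    by (simp add: algebra_simps)
qed

text \<open>For s > 1 the jump may blow up at minus infinity, so the contour cannot be collapsed
  directly. Instead s is lowered by 1 until it lies in (0, 1], the boundary term of the recurrence
  vanishing as L tends to infinity.\<close>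

lemma vint_hankel_tendsto:
  assumes "0 < s"
  shows "(vint (hankel s) \<longlongrightarrow> 2 * pi * \<i> * of_real (rGamma s)) at_top"
  using assms
proof (induction "nat \<lceil>s\<rceil>" arbitrary: s rule: less_induct)
  case less
  show ?case
  proof (cases "s \<le> 1")
    case True
    then show ?thesis using less.prems vint_hankel_tendsto_base by blast
  next
    case False
    then have "nat \<lceil>s - 1\<rceil> < nat \<lceil>s\<rceil>" "0 < s - 1"
      by linarith+
    then have IH: "(vint (hankel (s - 1)) \<longlongrightarrow> 2 * pi * \<i> * of_real (rGamma (s - 1))) at_top"
      by (rule less.hyps)
    have "(jump (hankel s) \<longlongrightarrow> 0) at_top"
    proof (rule tendsto_0_le)
      show "((\<lambda>L::real. exp (- exp L)) \<longlongrightarrow> 0) at_top"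
        by real_asymp
      show "\<forall>\<^sub>F L in at_top. norm (jump (hankel s) L) \<le> norm (exp (- exp L)) * 2"
        using eventually_ge_at_top[of 0]
      proof eventually_elim
        case (elim L)
        then have "(1 - s) * L - exp L \<le> - exp L"
          using False by (simp add: mult_nonpos_nonneg)
        then show ?case
          using norm_jump_hankel_le[of s L] by (smt (verit) exp_le_cancel_iff norm_exp real_norm_def exp_gt_zero)
      qed
    qed
    with IH have "((\<lambda>L. (vint (hankel (s - 1)) L - jump (hankel s) L) / of_real (s - 1)) \<longlongrightarrow>
        (2 * pi * \<i> * of_real (rGamma (s - 1)) - 0) / of_real (s - 1)) at_top"
      using False by (intro tendsto_intros) auto
    moreover have "(vint (hankel (s - 1)) L - jump (hankel s) L) / of_real (s - 1) = vint (hankel s) L" for L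
      using False by (simp add: vint_hankel_minus_1 del: of_real_diff)
    moreover have "(2 * pi * \<i> * of_real (rGamma (s - 1)) - 0) / of_real (s - 1) = 2 * pi * \<i> * of_real (rGamma s)"
    proof -
      have "rGamma (s - 1) = (s - 1) * rGamma s"
        using rGamma_plus1[of "s - 1"] by simp
      then show ?thesis
        using False by (simp del: of_real_diff)
    qed
    ultimately show ?thesis
      by simp
  qed
qed

text \<open>The form of the rate matters. For s = \<beta> k + 1 the factor
  \<open>exp ((1 - s) * L)\<close> is the k-th power of exp(-\<beta> L), which controls x^k in the
  series, while \<open>exp (- L)\<close> makes the total error vanish.\<close>

lemma norm_vint_hankel_tail_le:
  assumes "1 \<le> s" "0 \<le> L"
  shows "norm (2 * pi * \<i> * of_real (rGamma s) - vint (hankel s) L) \<le> 2 * exp ((1 - s) * L) * exp (- L)"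
proof (rule tendsto_upperbound)
  show "((\<lambda>M. norm (vint (hankel s) M - vint (hankel s) L)) \<longlongrightarrow>
      norm (2 * pi * \<i> * of_real (rGamma s) - vint (hankel s) L)) at_top"
    using assms by (intro tendsto_intros vint_hankel_tendsto) auto
  have D: "(vint (hankel s) has_vector_derivative jump (hankel s) v) (at v)" for v
    by (rule vint_has_vector_derivative[OF holomorphic_hankel, of "2 * pi"]) simp
  show "\<forall>\<^sub>F M in at_top. norm (vint (hankel s) M - vint (hankel s) L) \<le> 2 * exp ((1 - s) * L) * exp (- L)"
    using eventually_gt_at_top[of L]
  proof eventually_elim
    case (elim M)
    \<comment> \<open>A primitive of a bound on the jump: for v > L the exponent (1 - s) v - exp v
      is at most (1 - s) L - v, because 1 - s is nonpositive and v is at most exp v.\<close>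
    define \<phi> where "\<phi> = (\<lambda>v. - 2 * exp ((1 - s) * L) * exp (- v))"
    have "norm (vint (hankel s) M - vint (hankel s) L) \<le> \<phi> M - \<phi> L"
    proof (rule differentiable_bound_general[OF elim])
      show "continuous_on {L..M} (vint (hankel s))"
        by (rule continuous_on_vector_derivative) (rule has_vector_derivative_at_within[OF D])
      show "continuous_on {L..M} \<phi>"
        unfolding \<phi>_def by (intro continuous_intros)
      show "(vint (hankel s) has_vector_derivative jump (hankel s) v) (at v)" for v
        by (rule D)
      show "(\<phi> has_vector_derivative 2 * exp ((1 - s) * L) * exp (- v)) (at v)" for v
        unfolding \<phi>_def has_real_derivative_iff_has_vector_derivative[symmetric]
        by (auto intro!: derivative_eq_intros)
      show "norm (jump (hankel s) v) \<le> 2 * exp ((1 - s) * L) * exp (- v)" if "L < v" for v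
      proof -
        have "(1 - s) * v \<le> (1 - s) * L"
          using that assms by (intro mult_left_mono_neg) auto
        moreover have "v \<le> exp v"
          using exp_ge_add_one_self[of v] by linarith
        ultimately have "exp ((1 - s) * v - exp v) \<le> exp ((1 - s) * L) * exp (- v)"
          by (simp flip: exp_add)
        then show ?thesis
          using norm_jump_hankel_le[of s v] by linarith
      qed
    qed
    also have "\<dots> \<le> 2 * exp ((1 - s) * L) * exp (- L)"
      by (simp add: \<phi>_def)
    finally show ?case .
  qed
qed simp

section \<open>Kernels of the summed series and their collapse onto the cut\<close>

text \<open>With z = exp w this is exp(z) \<phi>(x z^(-\<beta>)); the factor 1 / z of the Hankel
  form is absorbed by dw = dz / z.\<close>

definition series_kernel :: "(complex \<Rightarrow> complex) \<Rightarrow> real \<Rightarrow> real \<Rightarrow> complex \<Rightarrow> complex" where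
  "series_kernel \<phi> \<beta> x w = exp (exp w) * \<phi> (of_real x * exp (- of_real \<beta> * w))"

lemma mult_exp_Complex_eq_rcis:
  "of_real x * exp (- of_real \<beta> * Complex v \<theta>) = rcis (x * exp (- \<beta> * v)) (- \<beta> * \<theta>)"
  by (simp add: complex_eq_iff Re_exp Im_exp)

text \<open>The only singularity of \<phi> is -1. For |\<theta>| < pi / \<beta> the argument
  -\<beta> \<theta> stays strictly between -pi and pi, so a real value of x exp(-\<beta> w) is
  positive. When \<beta> < 1 this strip is wider than the slit plane needs.\<close>

lemma holomorphic_series_kernel:
  assumes "0 < \<beta>" "0 < x" and \<phi>: "\<phi> holomorphic_on - {-1}"
  shows "series_kernel \<phi> \<beta> x holomorphic_on strip (pi / \<beta>)"
proof -
  have ne: "of_real x * exp (- of_real \<beta> * w) \<noteq> -1" if "w \<in> strip (pi / \<beta>)" for w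
  proof
    obtain v \<theta> where w: "w = Complex v \<theta>" by (cases w)
    define \<rho> where "\<rho> = x * exp (- \<beta> * v)"
    assume "of_real x * exp (- of_real \<beta> * w) = -1"
    then have *: "\<rho> * cos (- \<beta> * \<theta>) = -1" "\<rho> * sin (- \<beta> * \<theta>) = 0"
      unfolding w mult_exp_Complex_eq_rcis \<rho>_def by (simp_all add: complex_eq_iff)
    have "0 < \<rho>"
      using assms by (simp add: \<rho>_def)
    have "\<bar>\<theta>\<bar> < pi / \<beta>"
      using that by (simp add: w strip_def)
    then have "\<bar>- \<beta> * \<theta>\<bar> < pi"
      using assms by (simp add: abs_mult field_simps)
    then have "- \<beta> * \<theta> = 0"
      using * \<open>0 < \<rho>\<close> sin_zero_pi_iff by (metis less_irrefl mult_eq_0_iff)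
    then show False
      using *(1) \<open>0 < \<rho>\<close> by (simp only: cos_zero)
  qed
  have "(\<phi> \<circ> (\<lambda>w. of_real x * exp (- of_real \<beta> * w))) holomorphic_on strip (pi / \<beta>)"
  proof (rule holomorphic_on_compose_gen[OF _ \<phi>])
    show "(\<lambda>w. of_real x * exp (- of_real \<beta> * w)) ` strip (pi / \<beta>) \<subseteq> - {-1}"
      unfolding image_subset_iff Compl_iff singleton_iff using ne by (intro ballI)
  qed (intro holomorphic_intros)
  then show ?thesis
    unfolding series_kernel_def[abs_def] o_def by (intro holomorphic_intros)
qed

text \<open>For |\<theta>| at most pi the argument of \<phi> lies in the sector of half-angle
  \<beta> pi. Decay like C / \<rho> there gives the factor exp(\<beta> v), small at minus infinity,
  and the factor 1 / x, which later makes x times the jump bounded uniformly in x.\<close>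

lemma norm_series_kernel_le:
  assumes "0 < \<beta>" "0 < x" "\<bar>\<theta>\<bar> \<le> pi"
    and bound: "\<And>\<rho> \<alpha>. 0 < \<rho> \<Longrightarrow> \<bar>\<alpha>\<bar> \<le> \<beta> * pi \<Longrightarrow> norm (\<phi> (rcis \<rho> \<alpha>)) \<le> C / \<rho>"
  shows "norm (series_kernel \<phi> \<beta> x (Complex v \<theta>))
    \<le> norm (exp (exp (Complex v \<theta>))) * (C / x * exp (\<beta> * v))"
proof -
  have "norm (\<phi> (of_real x * exp (- of_real \<beta> * Complex v \<theta>))) \<le> C / (x * exp (- \<beta> * v))"
    unfolding mult_exp_Complex_eq_rcis using assms by (intro bound) (auto simp: abs_mult)
  also have "\<dots> = C / x * exp (\<beta> * v)"
    by (simp add: exp_minus field_simps)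
  finally show ?thesis
    unfolding series_kernel_def norm_mult by (intro mult_left_mono) auto
qed

lemma norm_jump_series_kernel_le:
  assumes "0 < \<beta>" "0 < x"
    and bound: "\<And>\<rho> \<alpha>. 0 < \<rho> \<Longrightarrow> \<bar>\<alpha>\<bar> \<le> \<beta> * pi \<Longrightarrow> norm (\<phi> (rcis \<rho> \<alpha>)) \<le> C / \<rho>"
  shows "norm (jump (series_kernel \<phi> \<beta> x) v) \<le> 2 * C / x * exp (\<beta> * v - exp v)"
proof -
  have "norm (series_kernel \<phi> \<beta> x (Complex v \<theta>)) \<le> exp (- exp v) * (C / x * exp (\<beta> * v))"
    if "\<theta> = pi \<or> \<theta> = - pi" for \<theta>
    using norm_series_kernel_le[OF assms(1,2) _ bound, of \<theta> v] that
    by (auto simp: exp_Complex_pi)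
  from this[of pi] this[of "- pi"]
  have "norm (jump (series_kernel \<phi> \<beta> x) v) \<le> 2 * (exp (- exp v) * (C / x * exp (\<beta> * v)))"
    unfolding jump_def using norm_triangle_ineq4 by (smt (verit))
  also have "\<dots> = 2 * C / x * exp (\<beta> * v - exp v)"
    by (simp add: exp_diff exp_minus field_simps)
  finally show ?thesis .
qed

lemma vint_series_kernel_tendsto:
  assumes \<beta>: "0 < \<beta>" "\<beta> < 1" and x: "0 < x" and \<phi>: "\<phi> holomorphic_on - {-1}"
    and bound: "\<And>\<rho> \<alpha>. 0 < \<rho> \<Longrightarrow> \<bar>\<alpha>\<bar> \<le> \<beta> * pi \<Longrightarrow> norm (\<phi> (rcis \<rho> \<alpha>)) \<le> C / \<rho>"
  shows "(vint (series_kernel \<phi> \<beta> x) \<longlongrightarrow> (LINT v|lborel. jump (series_kernel \<phi> \<beta> x) v)) at_top"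
proof -
  have b: "pi < pi / \<beta>"
    using \<beta> by (simp add: field_simps)
  note hol = holomorphic_series_kernel[OF \<beta>(1) x \<phi>]
  have C: "0 \<le> C"
    using order_trans[OF norm_ge_zero bound[of 1 0]] \<beta> by simp
  have "integrable lborel (jump (series_kernel \<phi> \<beta> x))"
  proof (rule Bochner_Integration.integrable_bound)
    show "integrable lborel (\<lambda>v. 2 * C / x * exp (\<beta> * v - exp v))"
      by (intro integrable_mult_right exp_substitution_Gamma_integral(1) \<beta>)
    show "jump (series_kernel \<phi> \<beta> x) \<in> borel_measurable lborel"
      using continuous_on_jump[OF hol b] by (simp add: borel_measurable_continuous_onI)
    show "AE v in lborel. norm (jump (series_kernel \<phi> \<beta> x) v) \<le> norm (2 * C / x * exp (\<beta> * v - exp v))"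
      using norm_jump_series_kernel_le[OF \<beta>(1) x bound] C x by simp
  qed
  moreover have "(vint (series_kernel \<phi> \<beta> x) \<longlongrightarrow> 2 * pi * \<i> * 0) at_bot"
  proof (rule vint_tendsto_at_bot[OF hol b])
    show "((\<lambda>L. exp (exp L) * exp (\<beta> * L) * (C / x)) \<longlongrightarrow> 0) at_bot"
      using tendsto_mult_right[OF exp_exp_mult_tendsto_at_bot[OF \<beta>(1)], of "C / x"] by simp
    fix L \<theta> :: real assume "\<bar>\<theta>\<bar> \<le> pi"
    then have "norm (series_kernel \<phi> \<beta> x (Complex L \<theta>))
        \<le> norm (exp (exp (Complex L \<theta>))) * (C / x * exp (\<beta> * L))"
      by (rule norm_series_kernel_le[OF \<beta>(1) x _ bound])
    also have "\<dots> \<le> exp (exp L) * (C / x * exp (\<beta> * L))"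
      using C x by (intro mult_right_mono norm_exp_exp_le) auto
    finally show "norm (series_kernel \<phi> \<beta> x (Complex L \<theta>) - 0) \<le> exp (exp L) * exp (\<beta> * L) * (C / x)"
      by (simp add: mult_ac)
  qed
  ultimately show ?thesis
    using vint_tendsto_at_top[OF hol b] by fastforce
qed

section \<open>Interchange of the series with the Hankel integral\<close>

lemma hankel_term_eq:
  "a * of_real x ^ k * hankel (\<beta> * real k + 1) w
     = exp (exp w) * (a * (of_real x * exp (- of_real \<beta> * w)) ^ k)"
proof -
  have "hankel (\<beta> * real k + 1) w = exp (exp w) * exp (- of_real \<beta> * w) ^ k"
    unfolding hankel_def exp_add exp_of_nat_mult[symmetric] by (simp add: algebra_simps)
  then show ?thesis
    by (simp add: power_mult_distrib)
qed

text \<open>Far enough to the right the argument of \<phi> has modulus at most 1/2 on the whole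
  segment, so its power series converges uniformly there and can be integrated term by term.\<close>

lemma vint_series_kernel_sums:
  assumes x: "0 < x" and L: "x * exp (- \<beta> * L) \<le> 1 / 2"
    and series: "\<And>\<zeta>. norm \<zeta> < 1 \<Longrightarrow> (\<lambda>k. a k * \<zeta> ^ k) sums \<phi> \<zeta>"
    and summ: "summable (\<lambda>k. norm (a k) * (1 / 2) ^ k)"
  shows "(\<lambda>k. a k * of_real x ^ k * vint (hankel (\<beta> * real k + 1)) L) sums vint (series_kernel \<phi> \<beta> x) L"
proof -
  define f where "f k \<theta> = a k * of_real x ^ k * hankel (\<beta> * real k + 1) (Complex L \<theta>)" for k \<theta>
  define \<zeta> where "\<zeta> \<theta> = of_real x * exp (- of_real \<beta> * Complex L \<theta>)" for \<theta>
  have norm_\<zeta>: "norm (\<zeta> \<theta>) \<le> 1 / 2" for \<theta>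
    using L x unfolding \<zeta>_def mult_exp_Complex_eq_rcis by simp
  have f_eq: "f k \<theta> = exp (exp (Complex L \<theta>)) * (a k * \<zeta> \<theta> ^ k)" for k \<theta>
    unfolding f_def \<zeta>_def by (rule hankel_term_eq)
  have f_sums: "(\<lambda>k. f k \<theta>) sums series_kernel \<phi> \<beta> x (Complex L \<theta>)" for \<theta>
    unfolding f_eq series_kernel_def \<zeta>_def[symmetric]
    using norm_\<zeta>[of \<theta>] by (intro sums_mult series) auto
  have cont: "continuous_on {-pi..pi} (f k)" for k
    unfolding f_def
    by (intro continuous_intros continuous_on_Complex_strip[OF holomorphic_hankel, of "2 * pi"]) auto
  have "uniform_limit {-pi..pi} (\<lambda>n \<theta>. \<Sum>k<n. f k \<theta>) (\<lambda>\<theta>. \<Sum>k. f k \<theta>) sequentially"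
  proof (rule Weierstrass_m_test)
    show "norm (f k \<theta>) \<le> exp (exp L) * (norm (a k) * (1 / 2) ^ k)" for k \<theta>
      unfolding f_eq norm_mult norm_power
      by (intro mult_mono power_mono norm_\<zeta> norm_exp_exp_le) auto
  qed (intro summable_mult summ)
  then have "uniform_limit {-pi..pi} (\<lambda>n \<theta>. \<Sum>k<n. f k \<theta>) (\<lambda>\<theta>. series_kernel \<phi> \<beta> x (Complex L \<theta>)) sequentially"
    using f_sums by (simp add: sums_iff)
  then obtain I J where I: "\<And>n. ((\<lambda>\<theta>. \<Sum>k<n. f k \<theta>) has_integral I n) {-pi..pi}"
    and J: "((\<lambda>\<theta>. series_kernel \<phi> \<beta> x (Complex L \<theta>)) has_integral J) {-pi..pi}" "I \<longlonglongrightarrow> J"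
    using cont by (elim uniform_limit_integral) (auto intro!: continuous_intros)
  have "\<i> * I n = (\<Sum>k<n. a k * of_real x ^ k * vint (hankel (\<beta> * real k + 1)) L)" for n
  proof -
    have "I n = (\<Sum>k<n. integral {-pi..pi} (f k))"
      using I[of n] integral_sum[of "{..<n}" f "{-pi..pi}"] cont integrable_continuous_real
      by (metis (no_types, lifting) finite_lessThan integral_unique)
    moreover have "\<i> * integral {-pi..pi} (f k) = a k * of_real x ^ k * vint (hankel (\<beta> * real k + 1)) L" for k
      unfolding vint_def f_def[abs_def] integral_mult_right by (simp only: mult_ac)
    ultimately show ?thesis
      by (simp only: sum_distrib_left)
  qed
  then show ?thesis
    using tendsto_mult_left[OF J(2), of \<i>] J(1) by (simp add: sums_def vint_def integral_unique)
qed

text \<open>The sum is exchanged with the limit in L: replacing every finite segment integral by its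
  Hankel limit changes the sum by at most exp(-L) times a constant. As L grows, the segment integral
  of the kernel tends to its integral over the cut.\<close>

lemma rGamma_series_eq_LINT:
  assumes \<beta>: "0 < \<beta>" "\<beta> < 1" and x: "0 < x" and \<phi>: "\<phi> holomorphic_on - {-1}"
    and series: "\<And>\<zeta>. norm \<zeta> < 1 \<Longrightarrow> (\<lambda>k. a k * \<zeta> ^ k) sums \<phi> \<zeta>"
    and bound: "\<And>\<rho> \<alpha>. 0 < \<rho> \<Longrightarrow> \<bar>\<alpha>\<bar> \<le> \<beta> * pi \<Longrightarrow> norm (\<phi> (rcis \<rho> \<alpha>)) \<le> C / \<rho>"
  shows "(\<lambda>k. 2 * pi * \<i> * (a k * of_real x ^ k * of_real (rGamma (\<beta> * real k + 1)))) sums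
    (LINT v|lborel. jump (series_kernel \<phi> \<beta> x) v)"
proof -
  define c where "c k = 2 * pi * \<i> * (a k * of_real x ^ k * of_real (rGamma (\<beta> * real k + 1)))" for k
  define A where "A = (\<Sum>k. norm (a k) * (1 / 2) ^ k)"
  have "summable (\<lambda>k. norm (a k * (1 / 2) ^ k))"
    \<comment> \<open>Any point strictly between 1/2 and 1 would do: convergence there gives
      absolute convergence at 1/2.\<close>
    using series[of "3 / 4"] by (intro powser_insidea[of a "3 / 4"]) (auto simp: sums_iff)
  then have summ: "summable (\<lambda>k. norm (a k) * (1 / 2) ^ k)"
    by (simp add: norm_mult norm_power norm_divide)
  \<comment> \<open>Beyond \<open>L0\<close> both x exp(-\<beta> L) is at most 1/2 and L is
    nonnegative, as the termwise integration and the tail estimate require.\<close>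
  define L0 where "L0 = max 0 (ln (2 * x) / \<beta>)"
  have key: "summable c \<and> norm (suminf c - vint (series_kernel \<phi> \<beta> x) L) \<le> exp (- L) * (2 * A)"
    if "L \<ge> L0" for L
  proof -
    have "0 \<le> L" "ln (2 * x) \<le> \<beta> * L"
      using that \<beta> by (auto simp: L0_def field_simps)
    then have "exp (ln (2 * x)) \<le> exp (\<beta> * L)"
      by simp
    then have L: "x * exp (- \<beta> * L) \<le> 1 / 2"
      using x by (simp add: exp_minus field_simps)
    define d where "d k = a k * of_real x ^ k * vint (hankel (\<beta> * real k + 1)) L" for k
    have d: "d sums vint (series_kernel \<phi> \<beta> x) L"
      unfolding d_def by (rule vint_series_kernel_sums[OF x L series summ])
    have le: "norm (c k - d k) \<le> exp (- L) * (2 * (norm (a k) * (1 / 2) ^ k))" for k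
    proof -
      define D where "D = 2 * pi * \<i> * of_real (rGamma (\<beta> * real k + 1)) - vint (hankel (\<beta> * real k + 1)) L"
      have "c k - d k = a k * of_real x ^ k * D"
        by (simp add: c_def d_def D_def algebra_simps)
      then have "norm (c k - d k) = norm (a k) * x ^ k * norm D"
        using x by (simp add: norm_mult norm_power)
      also have "\<dots> \<le> norm (a k) * x ^ k * (2 * exp ((1 - (\<beta> * real k + 1)) * L) * exp (- L))"
        unfolding D_def using \<beta> x \<open>0 \<le> L\<close>
        by (intro mult_left_mono norm_vint_hankel_tail_le) auto
      also have "exp ((1 - (\<beta> * real k + 1)) * L) = exp (- \<beta> * L) ^ k"
        unfolding exp_of_nat_mult[symmetric] by (simp add: algebra_simps)
      also have "norm (a k) * x ^ k * (2 * exp (- \<beta> * L) ^ k * exp (- L))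
          = exp (- L) * (2 * (norm (a k) * (x * exp (- \<beta> * L)) ^ k))"
        by (simp add: power_mult_distrib)
      also have "\<dots> \<le> exp (- L) * (2 * (norm (a k) * (1 / 2) ^ k))"
        using L x by (intro mult_left_mono power_mono) auto
      finally show ?thesis .
    qed
    have sm: "summable (\<lambda>k. exp (- L) * (2 * (norm (a k) * (1 / 2) ^ k)))"
      by (intro summable_mult summ)
    have cd: "summable (\<lambda>k. c k - d k)"
      by (rule summable_comparison_test'[OF sm, of 0]) (use le in auto)
    have "norm (\<Sum>k. c k - d k) \<le> (\<Sum>k. exp (- L) * (2 * (norm (a k) * (1 / 2) ^ k)))"
      by (rule norm_suminf_le[OF le sm])
    also have "\<dots> = exp (- L) * (2 * A)"
      unfolding A_def by (simp only: suminf_mult[OF summable_mult[OF summ]] suminf_mult[OF summ])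
    finally have "norm (\<Sum>k. c k - d k) \<le> exp (- L) * (2 * A)" .
    moreover have c: "summable c"
      using summable_add[OF cd sums_summable[OF d]] by simp
    moreover have "(\<Sum>k. c k - d k) = suminf c - vint (series_kernel \<phi> \<beta> x) L"
      using suminf_diff[OF c sums_summable[OF d]] sums_unique[OF d] by simp
    ultimately show ?thesis
      by simp
  qed
  have "((\<lambda>L. suminf c - vint (series_kernel \<phi> \<beta> x) L) \<longlongrightarrow> 0) at_top"
  proof (rule tendsto_0_le[where K = "\<bar>2 * A\<bar>"])
    show "((\<lambda>L::real. exp (- L)) \<longlongrightarrow> 0) at_top"
      by real_asymp
    show "\<forall>\<^sub>F L in at_top. norm (suminf c - vint (series_kernel \<phi> \<beta> x) L) \<le> norm (exp (- L)) * \<bar>2 * A\<bar>"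
      using eventually_ge_at_top[of L0]
    proof eventually_elim
      case (elim L)
      have "exp (- L) * (2 * A) \<le> norm (exp (- L)) * \<bar>2 * A\<bar>"
        by (simp add: mult_left_mono)
      then show ?case
        using key[OF elim] by linarith
    qed
  qed
  moreover have "((\<lambda>L. suminf c - vint (series_kernel \<phi> \<beta> x) L) \<longlongrightarrow>
      suminf c - (LINT v|lborel. jump (series_kernel \<phi> \<beta> x) v)) at_top"
    by (intro tendsto_intros vint_series_kernel_tendsto[OF \<beta> x \<phi> bound])
  ultimately have "suminf c - (LINT v|lborel. jump (series_kernel \<phi> \<beta> x) v) = 0"
    by (intro tendsto_unique[of at_top]) auto
  then show ?thesis
    using key[of L0] unfolding c_def[symmetric] by (simp add: sums_iff)
qed

section \<open>Asymptotics for large argument\<close>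

text \<open>With \<zeta> = x exp(-\<beta> w), x times the kernel equals
  \<open>hankel (1 - \<beta>) w\<close> times \<zeta> \<phi>(\<zeta>). As x grows, \<zeta> tends to
  infinity and the last factor to l, so dominated convergence on the cut leaves Hankel's integral
  for 1/Gamma(1 - \<beta>).\<close>

lemma mult_rGamma_series_tendsto:
  assumes \<beta>: "0 < \<beta>" "\<beta> < 1" and \<phi>: "\<phi> holomorphic_on - {-1}"
    and series: "\<And>\<zeta>. norm \<zeta> < 1 \<Longrightarrow> (\<lambda>k. a k * \<zeta> ^ k) sums \<phi> \<zeta>"
    and bound: "\<And>\<rho> \<alpha>. 0 < \<rho> \<Longrightarrow> \<bar>\<alpha>\<bar> \<le> \<beta> * pi \<Longrightarrow> norm (\<phi> (rcis \<rho> \<alpha>)) \<le> C / \<rho>"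
    and lim: "((\<lambda>\<zeta>. \<zeta> * \<phi> \<zeta>) \<longlongrightarrow> l) at_infinity"
  shows "((\<lambda>x. of_real x * (\<Sum>k. a k * of_real x ^ k * of_real (rGamma (\<beta> * real k + 1))))
    \<longlongrightarrow> l * of_real (rGamma (1 - \<beta>))) at_top"
proof -
  have b: "pi < pi / \<beta>"
    using \<beta> by (simp add: field_simps)
  \<comment> \<open>The value 0 for nonpositive x makes \<open>g x\<close> measurable for every x,
    as dominated convergence demands.\<close>
  define g where "g x v = (if 0 < x then of_real x * jump (series_kernel \<phi> \<beta> x) v else 0)" for x v
  have g_lim: "((\<lambda>x. LINT v|lborel. g x v) \<longlongrightarrow>
      (LINT v|lborel. l * jump (hankel (1 - \<beta>)) v)) at_top"
  proof (rule integral_dominated_convergence_at_top[where w = "\<lambda>v. 2 * C * exp (\<beta> * v - exp v)"])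
    show "integrable lborel (\<lambda>v. 2 * C * exp (\<beta> * v - exp v))"
      by (intro integrable_mult_right exp_substitution_Gamma_integral(1) \<beta>)
    show "\<forall>\<^sub>F x in at_top. AE v in lborel. norm (g x v) \<le> 2 * C * exp (\<beta> * v - exp v)"
      using eventually_gt_at_top[of 0]
    proof eventually_elim
      case (elim x)
      show ?case
        using norm_jump_series_kernel_le[OF \<beta>(1) elim bound] elim by (simp add: g_def norm_mult field_simps)
    qed
    have "((\<lambda>x. of_real x * series_kernel \<phi> \<beta> x w) \<longlongrightarrow> l * hankel (1 - \<beta>) w) at_top" for w
    proof -
      have inf: "filterlim (\<lambda>x. of_real x * exp (- of_real \<beta> * w)) at_infinity at_top"
        by (rule filterlim_norm_at_top_imp_at_infinity)
          (auto simp: norm_mult intro!: filterlim_at_top_mult_tendsto_pos[OF tendsto_const]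
              filterlim_abs_real filterlim_ident)
      have "((\<lambda>x. hankel (1 - \<beta>) w * (of_real x * exp (- of_real \<beta> * w) * \<phi> (of_real x * exp (- of_real \<beta> * w))))
          \<longlongrightarrow> hankel (1 - \<beta>) w * l) at_top"
        by (intro tendsto_mult tendsto_const filterlim_compose[OF lim inf])
      moreover have "hankel (1 - \<beta>) w * (of_real x * exp (- of_real \<beta> * w) * \<phi> (of_real x * exp (- of_real \<beta> * w)))
          = of_real x * series_kernel \<phi> \<beta> x w" for x
        by (simp add: hankel_def series_kernel_def exp_add exp_minus)
      ultimately show ?thesis
        by (simp only: mult.commute[of _ l])
    qed
    then have lim': "((\<lambda>x. of_real x * jump (series_kernel \<phi> \<beta> x) v) \<longlongrightarrow> l * jump (hankel (1 - \<beta>)) v) at_top" for v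
      unfolding jump_def right_diff_distrib by (intro tendsto_diff)
    have "((\<lambda>x. g x v) \<longlongrightarrow> l * jump (hankel (1 - \<beta>)) v) at_top" for v
      by (rule Lim_transform_eventually[OF lim'])
        (use eventually_gt_at_top[of 0] in eventually_elim, simp add: g_def)
    then show "AE v in lborel. ((\<lambda>x. g x v) \<longlongrightarrow> l * jump (hankel (1 - \<beta>)) v) at_top"
      by simp
    show "(\<lambda>v. l * jump (hankel (1 - \<beta>)) v) \<in> borel_measurable lborel"
      using LINT_jump_hankel(1)[of "1 - \<beta>"] \<beta> by auto
    show "g x \<in> borel_measurable lborel" for x
    proof (cases "0 < x")
      case True
      have "jump (series_kernel \<phi> \<beta> x) \<in> borel_measurable lborel"
        using continuous_on_jump[OF holomorphic_series_kernel[OF \<beta>(1) True \<phi>] b]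
        by (simp add: borel_measurable_continuous_onI)
      then show ?thesis
        using True by (simp add: g_def[abs_def])
    qed (simp add: g_def[abs_def])
  qed
  have hankel_int: "(LINT v|lborel. l * jump (hankel (1 - \<beta>)) v) = 2 * pi * \<i> * (l * of_real (rGamma (1 - \<beta>)))"
    using LINT_jump_hankel(2)[of "1 - \<beta>"] \<beta> by simp
  have g_eq: "\<forall>\<^sub>F x in at_top. (LINT v|lborel. g x v)
      = 2 * pi * \<i> * (of_real x * (\<Sum>k. a k * of_real x ^ k * of_real (rGamma (\<beta> * real k + 1))))"
    using eventually_gt_at_top[of 0]
  proof eventually_elim
    case (elim x)
    have "(\<lambda>k. a k * of_real x ^ k * of_real (rGamma (\<beta> * real k + 1))) sums
        ((LINT v|lborel. jump (series_kernel \<phi> \<beta> x) v) / (2 * pi * \<i>))"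
      using sums_divide[OF rGamma_series_eq_LINT[OF \<beta> elim \<phi> series bound], of "2 * pi * \<i>"] by simp
    then show ?case
      using elim by (simp add: sums_iff g_def)
  qed
  have "((\<lambda>x. 2 * pi * \<i> * (of_real x * (\<Sum>k. a k * of_real x ^ k * of_real (rGamma (\<beta> * real k + 1)))))
      \<longlongrightarrow> 2 * pi * \<i> * (l * of_real (rGamma (1 - \<beta>)))) at_top"
    using Lim_transform_eventually[OF g_lim g_eq] unfolding hankel_int .
  from tendsto_divide[OF this tendsto_const, of "2 * pi * \<i>"] show ?thesis
    by simp
qed

lemma real_rGamma_series:
  fixes a :: "nat \<Rightarrow> real"
  assumes \<beta>: "0 < \<beta>" "\<beta> < 1" and \<phi>: "\<phi> holomorphic_on - {-1}"
    and series: "\<And>\<zeta>. norm \<zeta> < 1 \<Longrightarrow> (\<lambda>k. of_real (a k) * \<zeta> ^ k) sums \<phi> \<zeta>"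
    and bound: "\<And>\<rho> \<alpha>. 0 < \<rho> \<Longrightarrow> \<bar>\<alpha>\<bar> \<le> \<beta> * pi \<Longrightarrow> norm (\<phi> (rcis \<rho> \<alpha>)) \<le> C / \<rho>"
    and lim: "((\<lambda>\<zeta>. \<zeta> * \<phi> \<zeta>) \<longlongrightarrow> of_real l) at_infinity"
  shows "0 < x \<Longrightarrow> summable (\<lambda>k. a k * x ^ k * rGamma (\<beta> * real k + 1))"
    and "((\<lambda>x. x * (\<Sum>k. a k * x ^ k * rGamma (\<beta> * real k + 1))) \<longlongrightarrow> l * rGamma (1 - \<beta>)) at_top"
proof -
  have summ: "summable (\<lambda>k. a k * x ^ k * rGamma (\<beta> * real k + 1))" if "0 < x" for x
  proof -
    have "summable (\<lambda>k. of_real (a k * x ^ k * rGamma (\<beta> * real k + 1)) :: complex)"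
      using sums_divide[OF rGamma_series_eq_LINT[OF \<beta> that \<phi> series bound], of "2 * pi * \<i>"]
      by (simp add: sums_iff)
    then show ?thesis
      by (rule summable_complex_of_real[THEN iffD1])
  qed
  then show "summable (\<lambda>k. a k * x ^ k * rGamma (\<beta> * real k + 1))" if "0 < x"
    using that .
  have "((\<lambda>x. complex_of_real (x * (\<Sum>k. a k * x ^ k * rGamma (\<beta> * real k + 1))))
      \<longlongrightarrow> of_real (l * rGamma (1 - \<beta>))) at_top"
  proof (rule Lim_transform_eventually)
    show "((\<lambda>x. of_real x * (\<Sum>k. of_real (a k) * of_real x ^ k * of_real (rGamma (\<beta> * real k + 1))))
      \<longlongrightarrow> complex_of_real (l * rGamma (1 - \<beta>))) at_top"
      using mult_rGamma_series_tendsto[OF \<beta> \<phi> series bound lim] by simp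
    show "\<forall>\<^sub>F x in at_top. of_real x * (\<Sum>k. of_real (a k) * of_real x ^ k * of_real (rGamma (\<beta> * real k + 1)))
        = complex_of_real (x * (\<Sum>k. a k * x ^ k * rGamma (\<beta> * real k + 1)))"
      using eventually_gt_at_top[of 0]
    proof eventually_elim
      case (elim x)
      show ?case
        using suminf_of_real[OF summ[OF elim], where 'a = complex] by simp
    qed
  qed
  then show "((\<lambda>x. x * (\<Sum>k. a k * x ^ k * rGamma (\<beta> * real k + 1))) \<longlongrightarrow> l * rGamma (1 - \<beta>)) at_top"
    unfolding tendsto_of_real_iff .
qed

section \<open>The two kernels for the series P and Q\<close>

text \<open>Since \<beta> pi < pi, the sector stays away from the ray through -1. This is the source
  of the C / \<rho> bounds on both kernels.\<close>

lemma sector_norm_bound: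
  assumes \<beta>: "0 < \<beta>" "\<beta> < 1"
  obtains \<kappa> where "0 < \<kappa>"
    "\<And>\<rho> \<alpha>. 0 < \<rho> \<Longrightarrow> \<bar>\<alpha>\<bar> \<le> \<beta> * pi \<Longrightarrow> \<kappa> * \<rho> \<le> norm (1 + rcis \<rho> \<alpha>)"
proof
  define \<gamma> where "\<gamma> = cos (\<beta> * pi)"
  have "cos pi < cos (\<beta> * pi)"
    using \<beta> by (intro cos_monotone_0_pi) auto
  then have \<gamma>: "-1 < \<gamma>"
    by (simp add: \<gamma>_def)
  then show "0 < sqrt ((1 + \<gamma>) / 2)"
    by simp
  have \<gamma>1: "\<gamma> \<le> 1"
    by (simp add: \<gamma>_def)
  fix \<rho> \<alpha> :: real assume \<rho>: "0 < \<rho>" and \<alpha>: "\<bar>\<alpha>\<bar> \<le> \<beta> * pi"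
  have "cos (\<beta> * pi) \<le> cos \<bar>\<alpha>\<bar>"
    using \<alpha> \<beta> by (intro cos_monotone_0_pi_le) auto
  then have "\<gamma> \<le> cos \<alpha>"
    by (simp add: \<gamma>_def)
  have "(sqrt ((1 + \<gamma>) / 2) * \<rho>)\<^sup>2 = (1 + \<gamma>) / 2 * \<rho>\<^sup>2"
    using \<gamma> by (simp add: power_mult_distrib)
  \<comment> \<open>The quadratic 1 + 2 \<rho> \<gamma> + \<rho>^2 is a convex combination of (1 +
    \<rho>)^2 and (1 - \<rho>)^2 with weights (1 + \<gamma>) / 2 and (1 - \<gamma>) / 2; the first
    weight yields the constant.\<close>
  also have "\<dots> \<le> (1 + \<gamma>) / 2 * (1 + \<rho>)\<^sup>2 + (1 - \<gamma>) / 2 * (1 - \<rho>)\<^sup>2"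
  proof -
    have "(1 + \<gamma>) / 2 * \<rho>\<^sup>2 \<le> (1 + \<gamma>) / 2 * (1 + \<rho>)\<^sup>2"
      using \<gamma> \<rho> by (intro mult_left_mono power_mono) auto
    moreover have "0 \<le> (1 - \<gamma>) / 2 * (1 - \<rho>)\<^sup>2"
      using \<gamma>1 by simp
    ultimately show ?thesis
      by linarith
  qed
  also have "\<dots> = 1 + 2 * \<rho> * \<gamma> + \<rho>\<^sup>2"
    by (simp add: power2_eq_square field_simps)
  also have "\<dots> \<le> 1 + 2 * \<rho> * cos \<alpha> + \<rho>\<^sup>2"
    using \<rho> \<open>\<gamma> \<le> cos \<alpha>\<close> by (intro add_mono mult_left_mono) auto
  also have "\<dots> = (1 + \<rho> * cos \<alpha>)\<^sup>2 + (\<rho> * sin \<alpha>)\<^sup>2"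
    using sin_cos_squared_add[of \<alpha>] by algebra
  also have "\<dots> = (norm (1 + rcis \<rho> \<alpha>))\<^sup>2"
    unfolding cmod_power2 by simp
  finally show "sqrt ((1 + \<gamma>) / 2) * \<rho> \<le> norm (1 + rcis \<rho> \<alpha>)"
    by (rule power2_le_imp_le) simp
qed

lemma tendsto_div_one_plus_at_infinity:
  "((\<lambda>\<zeta>::complex. \<zeta> / (1 + \<zeta>)) \<longlongrightarrow> 1) at_infinity"
proof (rule Lim_transform_eventually)
  have "filterlim (\<lambda>\<zeta>::complex. 1 + \<zeta>) at_infinity at_infinity"
    by (rule tendsto_add_filterlim_at_infinity[OF tendsto_const filterlim_ident])
  then have "((\<lambda>\<zeta>::complex. inverse (1 + \<zeta>)) \<longlongrightarrow> 0) at_infinity"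
    by (rule filterlim_compose[OF tendsto_inverse_0])
  from tendsto_diff[OF tendsto_const this, of 1]
  show "((\<lambda>\<zeta>::complex. 1 - inverse (1 + \<zeta>)) \<longlongrightarrow> 1) at_infinity"
    by simp
  show "\<forall>\<^sub>F \<zeta>::complex in at_infinity. 1 - inverse (1 + \<zeta>) = \<zeta> / (1 + \<zeta>)"
    unfolding eventually_at_infinity
  proof (intro exI allI impI)
    fix \<zeta> :: complex assume "2 \<le> norm \<zeta>"
    then have "1 + \<zeta> \<noteq> 0"
      by (auto simp: add_eq_0_iff)
    then show "1 - inverse (1 + \<zeta>) = \<zeta> / (1 + \<zeta>)"
      by (simp add: field_simps)
  qed
qed

text \<open>The first kernel is the geometric series 1 / (1 + \<zeta>). The second is its image
  under \<zeta> d/d\<zeta>, which multiplies the k-th coefficient by k. Multiplied by \<zeta>, they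
  tend to 1 and -1, hence the opposite signs of the limits.\<close>

lemma alternating_rGamma_series:
  fixes \<beta> :: real
  assumes \<beta>: "0 < \<beta>" "\<beta> < 1"
  shows "0 < x \<Longrightarrow> summable (\<lambda>k. (-1) ^ k * x ^ k * rGamma (\<beta> * real k + 1))"
    and "((\<lambda>x. x * (\<Sum>k. (-1) ^ k * x ^ k * rGamma (\<beta> * real k + 1))) \<longlongrightarrow> rGamma (1 - \<beta>)) at_top"
    and "((\<lambda>x. x * (\<Sum>k. real k * (-1) ^ k * x ^ k * rGamma (\<beta> * real k + 1))) \<longlongrightarrow> - rGamma (1 - \<beta>)) at_top"
proof -
  obtain \<kappa> where \<kappa>: "0 < \<kappa>"
    and le: "\<And>\<rho> \<alpha>. 0 < \<rho> \<Longrightarrow> \<bar>\<alpha>\<bar> \<le> \<beta> * pi \<Longrightarrow> \<kappa> * \<rho> \<le> norm (1 + rcis \<rho> \<alpha>)"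
    using sector_norm_bound[OF \<beta>] by blast
  have hol1: "(\<lambda>\<zeta>. 1 / (1 + \<zeta>)) holomorphic_on - {-1}"
    by (intro holomorphic_intros) (auto simp: add_eq_0_iff)
  have ser1: "(\<lambda>k. of_real ((-1) ^ k) * \<zeta> ^ k) sums (1 / (1 + \<zeta>))" if "norm \<zeta> < 1" for \<zeta> :: complex
    using geometric_sums[of "- \<zeta>"] that by (simp add: power_minus[of \<zeta>])
  have bd1: "norm (1 / (1 + rcis \<rho> \<alpha>)) \<le> (1 / \<kappa>) / \<rho>" if "0 < \<rho>" "\<bar>\<alpha>\<bar> \<le> \<beta> * pi" for \<rho> \<alpha>
  proof -
    have "1 / norm (1 + rcis \<rho> \<alpha>) \<le> 1 / (\<kappa> * \<rho>)"
      using le[OF that] \<kappa> that by (intro divide_left_mono) (auto intro!: mult_pos_pos intro: less_le_trans[of 0 "\<kappa> * \<rho>"])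
    then show ?thesis
      by (simp add: norm_divide)
  qed
  have lim1: "((\<lambda>\<zeta>::complex. \<zeta> * (1 / (1 + \<zeta>))) \<longlongrightarrow> of_real 1) at_infinity"
    using tendsto_div_one_plus_at_infinity by simp
  note R1 = real_rGamma_series[OF \<beta> hol1 ser1 bd1 lim1]
  show "0 < x \<Longrightarrow> summable (\<lambda>k. (-1) ^ k * x ^ k * rGamma (\<beta> * real k + 1))"
    by (rule R1(1))
  show "((\<lambda>x. x * (\<Sum>k. (-1) ^ k * x ^ k * rGamma (\<beta> * real k + 1))) \<longlongrightarrow> rGamma (1 - \<beta>)) at_top"
    using R1(2) by simp
  have hol2: "(\<lambda>\<zeta>. - \<zeta> / (1 + \<zeta>)\<^sup>2) holomorphic_on - {-1}"
    by (intro holomorphic_intros) (auto simp: add_eq_0_iff)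
  have ser2: "(\<lambda>k. of_real (real k * (-1) ^ k) * \<zeta> ^ k) sums (- \<zeta> / (1 + \<zeta>)\<^sup>2)"
    if "norm \<zeta> < 1" for \<zeta> :: complex
  proof -
    have "(\<lambda>n. - \<zeta> * (of_nat (Suc n) * (- \<zeta>) ^ n)) sums (- \<zeta> * (1 / (1 - (- \<zeta>))\<^sup>2))"
      using that by (intro sums_mult geometric_deriv_sums) simp
    then have "(\<lambda>n. of_nat (Suc n) * (- \<zeta>) ^ Suc n) sums (- \<zeta> / (1 + \<zeta>)\<^sup>2)"
      by (simp add: power_divide algebra_simps)
    \<comment> \<open>The index shift adds only the term k = 0, which is zero because of its factor
      k.\<close>
    from sums_Suc[OF this[folded One_nat_def]] show ?thesis
      by (simp add: power_minus[of \<zeta>] mult_ac)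
  qed
  have bd2: "norm (- rcis \<rho> \<alpha> / (1 + rcis \<rho> \<alpha>)\<^sup>2) \<le> (1 / \<kappa>\<^sup>2) / \<rho>"
    if "0 < \<rho>" "\<bar>\<alpha>\<bar> \<le> \<beta> * pi" for \<rho> \<alpha>
  proof -
    have "\<rho> / (norm (1 + rcis \<rho> \<alpha>))\<^sup>2 \<le> \<rho> / (\<kappa> * \<rho>)\<^sup>2"
      using le[OF that] \<kappa> that
      by (intro divide_left_mono power_mono) (auto intro!: mult_pos_pos zero_less_power intro: less_le_trans[of 0 "\<kappa> * \<rho>"])
    also have "\<dots> = (1 / \<kappa>\<^sup>2) / \<rho>"
      using that by (simp add: power2_eq_square field_simps)
    finally show ?thesis
      using that by (simp add: norm_divide norm_power)
  qed
  have lim2: "((\<lambda>\<zeta>::complex. \<zeta> * (- \<zeta> / (1 + \<zeta>)\<^sup>2)) \<longlongrightarrow> of_real (-1)) at_infinity"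
    using tendsto_minus[OF tendsto_mult[OF tendsto_div_one_plus_at_infinity tendsto_div_one_plus_at_infinity]]
    by (simp add: power2_eq_square)
  show "((\<lambda>x. x * (\<Sum>k. real k * (-1) ^ k * x ^ k * rGamma (\<beta> * real k + 1))) \<longlongrightarrow> - rGamma (1 - \<beta>)) at_top"
    using real_rGamma_series(2)[OF \<beta> hol2 ser2 bd2 lim2] by simp
qed

section \<open>The Mittag-Leffler function and the limit of the quotient\<close>

lemma mittag_leffler_eq_powser: "mittag_leffler \<beta> z = (\<Sum>k. rGamma (\<beta> * real k + 1) * z ^ k)"
  by (simp add: mittag_leffler_def rGamma_inverse_Gamma field_simps)

text \<open>The product z D is recorded because t u'(t) equals \<beta> z D at z = r t^\<beta>, and
  multiplying by z turns the differentiated series into the one with coefficients weighted by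
  k.\<close>

lemma mittag_leffler_derivative:
  fixes \<beta> z :: real
  assumes \<beta>: "0 < \<beta>" "\<beta> < 1"
  obtains D where "(mittag_leffler \<beta> has_field_derivative D) (at z)"
    "z * D = (\<Sum>k. real k * z ^ k * rGamma (\<beta> * real k + 1))"
proof
  define c where "c k = rGamma (\<beta> * real k + 1)" for k
  have summ: "summable (\<lambda>k. c k * y ^ k)" for y :: real
  proof (rule powser_inside)
    \<comment> \<open>The alternating series already converges for every positive x. So the power
      series converges at a negative point of modulus greater than |y|, hence at y.\<close>
    show "summable (\<lambda>k. c k * (- (\<bar>y\<bar> + 1)) ^ k)"
      using alternating_rGamma_series(1)[OF \<beta>, of "\<bar>y\<bar> + 1"]
      unfolding c_def power_minus[of "\<bar>y\<bar> + 1"] by (simp add: mult_ac)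
  qed simp
  have "mittag_leffler \<beta> = (\<lambda>z. \<Sum>k. c k * z ^ k)"
    by (simp add: fun_eq_iff mittag_leffler_eq_powser c_def)
  then show "(mittag_leffler \<beta> has_field_derivative (\<Sum>n. diffs c n * z ^ n)) (at z)"
    using termdiffs_strong_converges_everywhere[OF summ] by simp
  have "summable (\<lambda>n. diffs c n * z ^ n)"
    by (rule termdiff_converges_all) (rule summ)
  from sums_mult[OF diffs_equiv[OF this], of z]
  have "(\<lambda>n. z * (real n * c n * z ^ (n - Suc 0))) sums (z * (\<Sum>n. diffs c n * z ^ n))" .
  moreover have "z * (real n * c n * z ^ (n - Suc 0)) = real n * z ^ n * c n" for n
    by (cases n) auto
  ultimately have "(\<lambda>n. real n * z ^ n * c n) sums (z * (\<Sum>n. diffs c n * z ^ n))"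
    by (simp only:)
  then show "z * (\<Sum>n. diffs c n * z ^ n) = (\<Sum>k. real k * z ^ k * rGamma (\<beta> * real k + 1))"
    unfolding c_def[symmetric] by (rule sums_unique)
qed

theorem theorem4:
  fixes \<beta> r :: real and u :: "real \<Rightarrow> real"
  assumes "0 < \<beta>" and "\<beta> < 1" and "r < 0"
    and u_def: "\<And>t. t \<ge> 0 \<Longrightarrow> u t = mittag_leffler \<beta> (r * t powr \<beta>)"
  shows "((\<lambda>t. t * deriv u t / u t) \<longlongrightarrow> - \<beta>) at_top"
proof -
  note \<beta> = assms(1,2)
  define P where "P x = (\<Sum>k. (-1) ^ k * x ^ k * rGamma (\<beta> * real k + 1))" for x :: real
  define Q where "Q x = (\<Sum>k. real k * (-1) ^ k * x ^ k * rGamma (\<beta> * real k + 1))" for x :: real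
  have "rGamma (1 - \<beta>) \<noteq> 0"
    using \<beta> rGamma_eq_zero_iff[of "1 - \<beta>"] nonpos_Ints_nonpos[of "1 - \<beta>"] by auto
  \<comment> \<open>Both series decay like 1 / x; the common factor x gives numerator and
    denominator finite limits, the latter nonzero.\<close>
  then have "((\<lambda>x. \<beta> * ((x * Q x) / (x * P x))) \<longlongrightarrow> \<beta> * (- rGamma (1 - \<beta>) / rGamma (1 - \<beta>))) at_top"
    unfolding P_def Q_def by (intro tendsto_intros alternating_rGamma_series(2,3)[OF \<beta>])
  then have "((\<lambda>x. \<beta> * ((x * Q x) / (x * P x))) \<longlongrightarrow> - \<beta>) at_top"
    using \<open>rGamma (1 - \<beta>) \<noteq> 0\<close> by simp
  moreover have "filterlim (\<lambda>t. - r * t powr \<beta>) at_top at_top"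
    using assms by (intro filterlim_tendsto_pos_mult_at_top[OF tendsto_const] real_powr_at_top) auto
  ultimately have lim: "((\<lambda>t. \<beta> * ((- r * t powr \<beta> * Q (- r * t powr \<beta>)) / (- r * t powr \<beta> * P (- r * t powr \<beta>))))
      \<longlongrightarrow> - \<beta>) at_top"
    by (rule filterlim_compose)
  show ?thesis
  proof (rule Lim_transform_eventually[OF lim])
    show "\<forall>\<^sub>F t in at_top. \<beta> * ((- r * t powr \<beta> * Q (- r * t powr \<beta>)) / (- r * t powr \<beta> * P (- r * t powr \<beta>)))
        = t * deriv u t / u t"
      using eventually_gt_at_top[of 0]
    proof eventually_elim
      case (elim t)
      define z where "z = r * t powr \<beta>"
      have "z \<noteq> 0"
        using assms elim by (simp add: z_def)
      have neg: "(-1) ^ k * (- z) ^ k = z ^ k" for k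
        by (simp flip: power_mult_distrib)
      obtain D where D: "(mittag_leffler \<beta> has_field_derivative D) (at z)"
        and zD: "z * D = (\<Sum>k. real k * z ^ k * rGamma (\<beta> * real k + 1))"
        using mittag_leffler_derivative[OF \<beta>] .
      have "((\<lambda>t. r * t powr \<beta>) has_field_derivative r * (\<beta> * t powr (\<beta> - 1))) (at t)"
        using elim by (auto intro!: derivative_eq_intros)
      from DERIV_chain2[OF D[unfolded z_def] this]
      have "((\<lambda>t. mittag_leffler \<beta> (r * t powr \<beta>)) has_field_derivative D * (r * (\<beta> * t powr (\<beta> - 1)))) (at t)" .
      then have "(u has_field_derivative D * (r * (\<beta> * t powr (\<beta> - 1)))) (at t)"
        \<comment> \<open>The formula for \<open>u\<close> is given only on t >= 0, so the
          derivative is transferred on the open half-line around t.\<close>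
        by (rule has_field_derivative_transform_within_open[where S = "{0<..}"]) (use elim u_def in auto)
      then have "t * deriv u t = t * (D * (r * (\<beta> * t powr (\<beta> - 1))))"
        by (simp add: DERIV_imp_deriv)
      also have "\<dots> = \<beta> * (z * D)"
        using elim by (simp add: z_def powr_diff)
      also have "z * D = Q (- z)"
        unfolding zD Q_def using neg by (simp add: mult.assoc flip: neg)
      finally have "t * deriv u t = \<beta> * Q (- z)" .
      moreover have "u t = P (- z)"
        using elim u_def[of t] unfolding P_def neg by (simp add: mittag_leffler_eq_powser z_def mult.commute)
      ultimately show ?case
        using \<open>z \<noteq> 0\<close> by (simp add: z_def)
    qed
  qed
qed

end
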